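(* Let $p\ge 2$ and let $\{\phi_i\}_{1\le i\le p}$ be an orthonormal family of $L_2([0,1])$ with $\phi_1(t)=1$ for all $t\in[0,1]$; write $\phi=(\phi_1,\dots,\phi_p)^\top$. (i) The map $P_\phi$ coincides with the $L_2$-projection on $\{\phi_i\otimes\phi_j\}_{1\le i,j\le p}$: for every $c\in L_2([0,1]^2)$, $P_\phi(c)$ is the orthogonal projection, in $L_2([0,1]^2)$ with its usual scalar product, of $c$ onto the linear span of $\{\phi_i\otimes\phi_j\}_{1\le i,j\le p}$. (ii) Moreover, these projections give rise to densities of copula in $\mathcal{C}_\phi$ if and only if $I_p\in\mathcal{A}_\phi$: one has $P_\phi(c)\in\mathcal{C}_\phi$ for every copula density $c\in L_2([0,1]^2)$ if and only if $I_p\in\mathcal{A}_\phi$.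
   Context: $I_p$ is the $p\times p$ identity matrix and $e_1$ is the first canonical basis vector of $\mathbb{R}^p$. Define $$\mathcal{A}_\phi=\{A\in\mathbb{R}^{p\times p}:\ Ae_1=e_1,\ A^\top e_1=e_1,\ \phi(u)^\top A\,\phi(v)\ge 0\ \ \forall (u,v)\in[0,1]^2\},$$ $$\mathcal{C}_\phi=\{c:[0,1]^2\to\mathbb{R}:\ c(u,v)=\phi(u)^\top A\,\phi(v)\ \ \forall (u,v)\in[0,1]^2, \text{ for some } A\in\mathcal{A}_\phi\}.$$ For $c\in L_2([0,1]^2)$, $$T_\phi(c)=\int_0^1\int_0^1 c(x,y)\,\phi(x)\phi(y)^\top\,dx\,dy\in\mathbb{R}^{p\times p},\qquad P_\phi(c)(u,v)=\phi(u)^\top T_\phi(c)\,\phi(v),\ (u,v)\in[0,1]^2.$$ The tensor product is $(f\otimes g)(u,v)=f(u)g(v)$. A copula density is a nonnegative function on $[0,1]^2$ that is the density of a distribution with both margins uniform on $[0,1]$. *)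

theory Defs
  imports "HOL-Analysis.Analysis" "HOL-Library.Function_Algebras"
begin

definition L2 :: "'a measure \<Rightarrow> ('a \<Rightarrow> real) set" where
  "L2 M = {f \<in> borel_measurable M. integrable M (\<lambda>x. (f x)\<^sup>2)}"

definition L2_inner :: "'a measure \<Rightarrow> ('a \<Rightarrow> real) \<Rightarrow> ('a \<Rightarrow> real) \<Rightarrow> real" where
  "L2_inner M f g = (LINT x|M. f x * g x)"

definition L2_orthonormal :: "'a measure \<Rightarrow> ('i \<Rightarrow> 'a \<Rightarrow> real) \<Rightarrow> bool" where
  "L2_orthonormal M f \<longleftrightarrow>
     (\<forall>i. f i \<in> L2 M) \<and> (\<forall>i j. L2_inner M (f i) (f j) = (if i = j then 1 else 0))"

interpretation real_fun: vector_space "\<lambda>(a::real) (f::'a \<Rightarrow> real) x. a * f x"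
  by unfold_locales (auto simp: algebra_simps fun_eq_iff)

definition is_L2_projection ::
  "'a measure \<Rightarrow> ('a \<Rightarrow> real) set \<Rightarrow> ('a \<Rightarrow> real) \<Rightarrow> ('a \<Rightarrow> real) \<Rightarrow> bool" where
  "is_L2_projection M V f g \<longleftrightarrow>
     f \<in> L2 M \<and> V \<subseteq> L2 M \<and> g \<in> V \<and> (\<forall>h\<in>V. L2_inner M (\<lambda>x. f x - g x) h = 0)"

definition tensor :: "('a \<Rightarrow> real) \<Rightarrow> ('b \<Rightarrow> real) \<Rightarrow> 'a \<times> 'b \<Rightarrow> real"  (infixr "\<otimes>" 70) where
  "f \<otimes> g = (\<lambda>(u, v). f u * g v)"

abbreviation unit_square :: "(real \<times> real) set" where
  "unit_square \<equiv> {0..1} \<times> {0..1}"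

text \<open>The margins are compared as measures on the Borel sets of the real line.\<close>

definition copula_density :: "(real \<times> real \<Rightarrow> real) \<Rightarrow> bool" where
  "copula_density c \<longleftrightarrow>
     c \<in> borel_measurable (lebesgue_on unit_square) \<and>
     (\<forall>z\<in>unit_square. 0 \<le> c z) \<and>
     distr (density (lebesgue_on unit_square) (\<lambda>z. ennreal (c z))) borel fst
       = uniform_measure lborel {0..1} \<and>
     distr (density (lebesgue_on unit_square) (\<lambda>z. ennreal (c z))) borel snd
       = uniform_measure lborel {0..1}"

text \<open>
  The family is a vector-valued function, and the index \<open>k\<close> is the position of the constant
  function in it, so that \<open>axis k 1\<close> plays the role of the first canonical basis vector.
\<close>

definition admissible_matrices :: "'p \<Rightarrow> (real \<Rightarrow> real^'p) \<Rightarrow> (real^'p^'p::finite) set" where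
  "admissible_matrices k \<phi> =
     {A. A *v axis k 1 = axis k 1 \<and> transpose A *v axis k 1 = axis k 1 \<and>
         (\<forall>u\<in>{0..1}. \<forall>v\<in>{0..1}. 0 \<le> \<phi> u \<bullet> (A *v \<phi> v))}"

text \<open>Only the values on the unit square matter for membership.\<close>

definition copula_class :: "'p::finite \<Rightarrow> (real \<Rightarrow> real^'p) \<Rightarrow> (real \<times> real \<Rightarrow> real) set" where
  "copula_class k \<phi> =
     {c. \<exists>A\<in>admissible_matrices k \<phi>. \<forall>u\<in>{0..1}. \<forall>v\<in>{0..1}. c (u, v) = \<phi> u \<bullet> (A *v \<phi> v)}"

definition coefficient_matrix ::
  "(real \<Rightarrow> real^'p) \<Rightarrow> (real \<times> real \<Rightarrow> real) \<Rightarrow> real^'p^'p::finite" where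
  "coefficient_matrix \<phi> c =
     (\<chi> i j. LINT (x, y)|lebesgue_on unit_square. c (x, y) * (\<phi> x $ i * \<phi> y $ j))"

definition copula_projection ::
  "(real \<Rightarrow> real^'p::finite) \<Rightarrow> (real \<times> real \<Rightarrow> real) \<Rightarrow> real \<times> real \<Rightarrow> real" where
  "copula_projection \<phi> c = (\<lambda>(u, v). \<phi> u \<bullet> (coefficient_matrix \<phi> c *v \<phi> v))"

end

theory Submission
  imports Defs
begin

text \<open>
For an orthonormal family \<open>\<phi>\<close> the tensors \<open>\<phi>\<^sub>i \<otimes> \<phi>\<^sub>j\<close> are orthonormal on the square by Fubini, and
\<open>copula_projection \<phi> c\<close> is the Fourier sum of \<open>c\<close> in this family. This gives the first claim
(\<open>copula_projection_is_L2_projection\<close>).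

For the second claim, the basic formula is
\<open>copula_projection \<phi> c (u, v) = \<integral> c(x, y) (\<phi> u \<bullet> \<phi> x) (\<phi> v \<bullet> \<phi> y) dx dy\<close>
(\<open>copula_projection_kernel\<close>). If the identity matrix is admissible, both inner products are nonnegative
on the unit interval, and so is the projection of any copula density. The uniform margins give
\<open>\<integral> c(x, y) h(x) dx dy = \<integral> h\<close>, and likewise for \<open>y\<close>; with \<open>h = \<phi>\<^sub>i\<close> this says that the row
and the column of the coefficient matrix that belong to the constant function are unit vectors
(\<open>coefficient_matrix_copula_axis\<close>). So the coefficient matrix itself is admissible.

For the converse one needs copula densities that concentrate near the diagonal, because
\<open>\<phi> u \<bullet> \<phi> v\<close> is formally the projection of the uniform distribution on the diagonal. The inequality has to
be proved for every single pair \<open>(u, v)\<close>, and \<open>\<phi>\<close> is merely square integrable, so the densities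
are adapted to \<open>\<phi>\<close>: approximate \<open>\<phi>\<close> by a simple function \<open>F\<close> and let \<open>block_density F\<close>
be the density that spreads the mass \<open>|B|\<close> uniformly over the square \<open>B \<times> B\<close>, for each
fibre \<open>B\<close> of \<open>F\<close>. On its support \<open>F x = F y\<close>, hence \<open>\<phi> x\<close> and \<open>\<phi> y\<close> are close. With
\<open>s = \<phi> u \<bullet> \<phi>\<close> and \<open>t = \<phi> v \<bullet> \<phi>\<close>, the identity
\<open>s x t y + t x s y = s x t x + s y t y - (s x - s y) (t x - t y)\<close>
and the margins show that the symmetrised projection exceeds \<open>2 (\<phi> u \<bullet> \<phi> v)\<close> by at most
\<open>4 |\<phi> u| |\<phi> v| \<integral> |\<phi> - F|\<^sup>2\<close> (\<open>copula_projection_le_inner\<close>). The error tends to \<open>0\<close> along a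
sequence of simple functions, so nonnegativity of all the projections forces
\<open>\<phi> u \<bullet> \<phi> v \<ge> 0\<close> (\<open>kernel_nonneg_of_copula_projections_nonneg\<close>).
\<close>

section \<open>Coordinate projections and Lebesgue measurability\<close>

lemma null_sets_vimage_fst:
  fixes N :: "'a::euclidean_space set"
  assumes "N \<in> null_sets lborel"
  shows "(fst :: 'a \<times> 'b::euclidean_space \<Rightarrow> 'a) -` N \<in> null_sets lborel"
proof -
  have N: "N \<in> sets lborel" "emeasure lborel N = 0"
    by (rule null_setsD2[OF assms], rule null_setsD1[OF assms])
  then have "N \<times> (UNIV :: 'b set) \<in> null_sets (lborel \<Otimes>\<^sub>M lborel)"
    by (intro null_setsI pair_measureI) (simp_all add: lborel.emeasure_pair_measure_Times)
  then show ?thesis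
    by (simp add: lborel_prod vimage_fst)
qed

lemma null_sets_vimage_snd:
  fixes N :: "'b::euclidean_space set"
  assumes "N \<in> null_sets lborel"
  shows "(snd :: 'a::euclidean_space \<times> 'b \<Rightarrow> 'b) -` N \<in> null_sets lborel"
proof -
  have N: "N \<in> sets lborel" "emeasure lborel N = 0"
    by (rule null_setsD2[OF assms], rule null_setsD1[OF assms])
  then have "(UNIV :: 'a set) \<times> N \<in> null_sets (lborel \<Otimes>\<^sub>M lborel)"
    by (intro null_setsI pair_measureI) (simp_all add: lborel.emeasure_pair_measure_Times)
  then show ?thesis
    by (simp add: lborel_prod vimage_snd)
qed

text \<open>
Borel measurability alone does not suffice: a Lebesgue set differs from a Borel set by a subset of a
Borel null set, and such subsets are pulled back to measurable sets because Lebesgue measure is complete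
and preimages of null sets are null.
\<close>

lemma measurable_lebesgue_on_vimage:
  fixes q :: "'a::euclidean_space \<Rightarrow> 'b::euclidean_space"
  assumes q: "q \<in> borel_measurable borel" "q \<in> X \<rightarrow> S"
    and null: "\<And>N. N \<in> null_sets lborel \<Longrightarrow> q -` N \<in> null_sets lborel"
  shows "q \<in> lebesgue_on X \<rightarrow>\<^sub>M lebesgue_on S"
proof (rule measurable_restrict_space3[OF _ q(2)])
  have "q \<in> (lebesgue :: 'a measure) \<rightarrow>\<^sub>M lborel"
    using q(1) by (simp add: measurable_completion)
  moreover from this have "null_sets lborel \<subseteq> null_sets (distr (lebesgue :: 'a measure) lborel q)"
    using null by (fastforce simp: null_sets_def emeasure_distr sets_completionI_sets)
  ultimately show "q \<in> (lebesgue :: 'a measure) \<rightarrow>\<^sub>M lebesgue"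
    by (rule completion.measurable_completion2)
qed

lemma AE_lebesgue_on_vimage:
  fixes q :: "'a::euclidean_space \<Rightarrow> 'b::euclidean_space"
  assumes X: "X \<in> sets lebesgue" and S: "S \<in> sets lebesgue"
    and q: "q \<in> X \<rightarrow> S"
    and null: "\<And>N. N \<in> null_sets lborel \<Longrightarrow> q -` N \<in> null_sets lborel"
    and ae: "AE x in lebesgue_on S. P x"
  shows "AE z in lebesgue_on X. P (q z)"
proof -
  have "AE x in lborel. x \<in> S \<longrightarrow> P x"
    using ae S by (simp add: AE_restrict_space_iff AE_completion_iff)
  then obtain N where N: "N \<in> null_sets lborel" "{x. \<not> (x \<in> S \<longrightarrow> P x)} \<subseteq> N"
    by (auto simp: eventually_ae_filter)
  have "AE z in lborel. z \<notin> q -` N"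
    by (intro AE_not_in null N)
  then have "AE z in lborel. z \<in> X \<longrightarrow> P (q z)"
    by (rule eventually_mono) (use N(2) q in auto)
  then show ?thesis
    using X by (simp add: AE_restrict_space_iff AE_completion_iff)
qed

lemma measurable_fst_lebesgue: "fst \<in> (lebesgue :: ('a::euclidean_space \<times> 'b::euclidean_space) measure) \<rightarrow>\<^sub>M lebesgue"
proof -
  have "fst \<in> lebesgue_on (UNIV :: ('a \<times> 'b) set) \<rightarrow>\<^sub>M lebesgue_on UNIV"
    by (rule measurable_lebesgue_on_vimage[OF _ _ null_sets_vimage_fst])
      (auto simp: borel_prod[symmetric])
  then show ?thesis
    by (simp only: lebesgue_on_UNIV_eq)
qed

lemma measurable_snd_lebesgue: "snd \<in> (lebesgue :: ('a::euclidean_space \<times> 'b::euclidean_space) measure) \<rightarrow>\<^sub>M lebesgue"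
proof -
  have "snd \<in> lebesgue_on (UNIV :: ('a \<times> 'b) set) \<rightarrow>\<^sub>M lebesgue_on UNIV"
    by (rule measurable_lebesgue_on_vimage[OF _ _ null_sets_vimage_snd])
      (auto simp: borel_prod[symmetric])
  then show ?thesis
    by (simp only: lebesgue_on_UNIV_eq)
qed

lemma AE_lebesgue_fst:
  assumes "AE x in lebesgue. P x"
  shows "AE z in (lebesgue :: ('a::euclidean_space \<times> 'b::euclidean_space) measure). P (fst z)"
proof -
  have "AE z :: 'a \<times> 'b in lebesgue_on UNIV. P (fst z)"
    by (rule AE_lebesgue_on_vimage[OF _ _ _ null_sets_vimage_fst, of _ UNIV])
      (use assms in \<open>simp_all only: lebesgue_on_UNIV_eq sets.top Pi_UNIV UNIV_I space_lborel\<close>, auto)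
  then show ?thesis
    by (simp only: lebesgue_on_UNIV_eq)
qed

lemma AE_lebesgue_snd:
  assumes "AE x in lebesgue. P x"
  shows "AE z in (lebesgue :: ('a::euclidean_space \<times> 'b::euclidean_space) measure). P (snd z)"
proof -
  have "AE z :: 'a \<times> 'b in lebesgue_on UNIV. P (snd z)"
    by (rule AE_lebesgue_on_vimage[OF _ _ _ null_sets_vimage_snd, of _ UNIV])
      (use assms in \<open>simp_all only: lebesgue_on_UNIV_eq sets.top Pi_UNIV UNIV_I space_lborel\<close>, auto)
  then show ?thesis
    by (simp only: lebesgue_on_UNIV_eq)
qed

lemma sets_lebesgue_Times:
  fixes S :: "'a::euclidean_space set" and T :: "'b::euclidean_space set"
  assumes "S \<in> sets lebesgue" "T \<in> sets lebesgue"
  shows "S \<times> T \<in> sets lebesgue"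
proof -
  from measurable_sets[OF measurable_fst_lebesgue assms(1)] measurable_sets[OF measurable_snd_lebesgue assms(2)]
  have "fst -` S \<inter> snd -` T \<in> sets (lebesgue :: ('a \<times> 'b) measure)"
    unfolding space_completion space_lborel space_borel Int_UNIV_right by (rule sets.Int)
  moreover have "fst -` S \<inter> snd -` T = S \<times> T"
    by auto
  ultimately show ?thesis
    by simp
qed

lemma measurable_fst_lebesgue_on:
  fixes S :: "'a::euclidean_space set" and T :: "'b::euclidean_space set"
  shows "fst \<in> lebesgue_on (S \<times> T) \<rightarrow>\<^sub>M lebesgue_on S"
  by (rule measurable_restrict_space3[OF measurable_fst_lebesgue]) auto

lemma measurable_snd_lebesgue_on:
  fixes S :: "'a::euclidean_space set" and T :: "'b::euclidean_space set"
  shows "snd \<in> lebesgue_on (S \<times> T) \<rightarrow>\<^sub>M lebesgue_on T"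
  by (rule measurable_restrict_space3[OF measurable_snd_lebesgue]) auto

section \<open>Integrals of tensor products\<close>

text \<open>
The almost everywhere equality is recorded both on \<open>S\<close> and, for the extension by zero, on the whole
space; the latter is the form in which Fubini's theorem for Borel functions applies.
\<close>

lemma borel_version_lebesgue_on:
  fixes f :: "'a::euclidean_space \<Rightarrow> real"
  assumes S: "S \<in> sets lebesgue" and f: "f \<in> borel_measurable (lebesgue_on S)"
  obtains g where "g \<in> borel_measurable borel" "AE x in lebesgue. indicator S x * f x = g x"
    "AE x in lebesgue_on S. f x = g x"
proof -
  have "(\<lambda>x. indicator S x * f x) \<in> borel_measurable lebesgue"
    using f S by (simp add: borel_measurable_restrict_space_iff)
  from completion_ex_borel_measurable_real[OF this]
  obtain g where g: "g \<in> borel_measurable lborel" "AE x in lborel. indicator S x * f x = g x"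
    by auto
  then have "AE x in lebesgue. indicator S x * f x = g x"
    by (simp add: AE_completion)
  moreover from this have "AE x in lebesgue_on S. f x = g x"
    using S by (auto simp: AE_restrict_space_iff elim!: eventually_mono)
  ultimately show thesis
    using g(1) by (intro that) auto
qed


text \<open>
Lebesgue measure on the product space is the completion of a product measure, and Fubini's theorem holds
for Borel functions and the product measure. Replacing both factors by Borel versions reduces to that case,
as it changes the tensor product on a null set only.
\<close>

lemma
  fixes f :: "'a::euclidean_space \<Rightarrow> real" and g :: "'b::euclidean_space \<Rightarrow> real"
  assumes S: "S \<in> sets lebesgue" and T: "T \<in> sets lebesgue"
    and f: "integrable (lebesgue_on S) f" and g: "integrable (lebesgue_on T) g"
  shows integrable_tensor: "integrable (lebesgue_on (S \<times> T)) (f \<otimes> g)"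
    and integral_tensor: "integral\<^sup>L (lebesgue_on (S \<times> T)) (f \<otimes> g) =
      integral\<^sup>L (lebesgue_on S) f * integral\<^sup>L (lebesgue_on T) g"
proof -
  note ST = sets_lebesgue_Times[OF S T]
  obtain f' where f': "f' \<in> borel_measurable borel" "AE x in lebesgue. indicator S x * f x = f' x"
    by (rule borel_version_lebesgue_on[OF S borel_measurable_integrable[OF f]])
  obtain g' where g': "g' \<in> borel_measurable borel" "AE x in lebesgue. indicator T x * g x = g' x"
    by (rule borel_version_lebesgue_on[OF T borel_measurable_integrable[OF g]])
  have meas_f: "(\<lambda>x. indicator S x * f x) \<in> borel_measurable lebesgue"
    using borel_measurable_integrable[OF f] S by (simp add: borel_measurable_restrict_space_iff)
  have meas_g: "(\<lambda>x. indicator T x * g x) \<in> borel_measurable lebesgue"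
    using borel_measurable_integrable[OF g] T by (simp add: borel_measurable_restrict_space_iff)
  have meas': "f' \<in> borel_measurable lebesgue" "g' \<in> borel_measurable lebesgue"
    using f'(1) g'(1) by (simp_all add: measurable_completion)
  have int_f': "integrable lborel f'"
    using f S f'(1) integrable_cong_AE[OF meas_f meas'(1) f'(2)]
    by (simp add: integrable_restrict_space integrable_completion)
  have int_g': "integrable lborel g'"
    using g T g'(1) integrable_cong_AE[OF meas_g meas'(2) g'(2)]
    by (simp add: integrable_restrict_space integrable_completion)
  have If: "integral\<^sup>L (lebesgue_on S) f = integral\<^sup>L lborel f'"
    using S f'(1) integral_cong_AE[OF meas_f meas'(1) f'(2)]
    by (simp add: integral_restrict_space integral_completion)
  have Ig: "integral\<^sup>L (lebesgue_on T) g = integral\<^sup>L lborel g'"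
    using T g'(1) integral_cong_AE[OF meas_g meas'(2) g'(2)]
    by (simp add: integral_restrict_space integral_completion)
  have meas_t: "f' \<otimes> g' \<in> borel_measurable (lborel \<Otimes>\<^sub>M lborel)"
    using f'(1) g'(1) by (simp add: tensor_def)
  have int_t: "integrable (lborel \<Otimes>\<^sub>M lborel) (f' \<otimes> g')"
    using meas_t int_f' int_g'
    by (intro lborel_pair.Fubini_integrable) (auto simp: tensor_def abs_mult)
  have I_t: "integral\<^sup>L (lborel \<Otimes>\<^sub>M lborel) (f' \<otimes> g') = integral\<^sup>L lborel f' * integral\<^sup>L lborel g'"
    using lborel_pair.integral_fst'[OF int_t] by (simp add: tensor_def)
  define h where "h = (\<lambda>z. indicator (S \<times> T) z *\<^sub>R (f \<otimes> g) z)"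
  have h_eq: "h = (\<lambda>z. (indicator S (fst z) * f (fst z)) * (indicator T (snd z) * g (snd z)))"
    unfolding h_def by (auto simp: tensor_def indicator_def)
  have meas_S: "(\<lambda>z :: 'a \<times> 'b. indicator S (fst z) * f (fst z)) \<in> borel_measurable lebesgue"
    by (rule measurable_compose[OF measurable_fst_lebesgue meas_f])
  have meas_T: "(\<lambda>z :: 'a \<times> 'b. indicator T (snd z) * g (snd z)) \<in> borel_measurable lebesgue"
    by (rule measurable_compose[OF measurable_snd_lebesgue meas_g])
  have meas_h: "h \<in> borel_measurable lebesgue"
    unfolding h_eq by (rule borel_measurable_times[OF meas_S meas_T])
  have "AE z :: 'a \<times> 'b in lebesgue. indicator S (fst z) * f (fst z) = f' (fst z)"
    by (rule AE_lebesgue_fst[OF f'(2)])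
  moreover have "AE z :: 'a \<times> 'b in lebesgue. indicator T (snd z) * g (snd z) = g' (snd z)"
    by (rule AE_lebesgue_snd[OF g'(2)])
  ultimately have ae: "AE z in lebesgue. (f' \<otimes> g') z = h z"
    by (rule AE_mp[OF _ AE_mp[OF _ AE_I2]]) (simp add: h_eq tensor_def split_beta)
  have t: "f' \<otimes> g' \<in> borel_measurable lborel" "integrable lborel (f' \<otimes> g')"
    using meas_t int_t by (simp_all add: lborel_prod)
  then have mt: "f' \<otimes> g' \<in> borel_measurable lebesgue"
    by (simp add: measurable_completion)
  show "integrable (lebesgue_on (S \<times> T)) (f \<otimes> g)"
    using t integrable_cong_AE[OF mt meas_h ae] ST
    by (simp add: integrable_restrict_space integrable_completion h_def)
  show "integral\<^sup>L (lebesgue_on (S \<times> T)) (f \<otimes> g) =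
      integral\<^sup>L (lebesgue_on S) f * integral\<^sup>L (lebesgue_on T) g"
    using t(1) integral_cong_AE[OF mt meas_h ae] ST I_t
    by (simp add: integral_restrict_space integral_completion If Ig h_def lborel_prod)
qed

section \<open>Orthogonal projection in the space of square integrable functions\<close>

lemma L2_mult_integrable:
  assumes "f \<in> L2 M" "g \<in> L2 M"
  shows "integrable M (\<lambda>x. f x * g x)"
proof (rule Bochner_Integration.integrable_bound)
  show "integrable M (\<lambda>x. (f x)\<^sup>2 + (g x)\<^sup>2)"
    using assms by (simp add: L2_def)
  show "(\<lambda>x. f x * g x) \<in> borel_measurable M"
    using assms by (auto simp: L2_def)
  have "\<bar>a * b\<bar> \<le> \<bar>a\<^sup>2 + b\<^sup>2\<bar>" for a b :: real
  proof -
    have "2 * (\<bar>a\<bar> * \<bar>b\<bar>) \<le> a\<^sup>2 + b\<^sup>2" "0 \<le> \<bar>a\<bar> * \<bar>b\<bar>"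
      using sum_squares_bound[of "\<bar>a\<bar>" "\<bar>b\<bar>"] by (simp_all add: mult.assoc)
    then show ?thesis
      unfolding abs_mult by linarith
  qed
  then show "AE x in M. norm (f x * g x) \<le> norm ((f x)\<^sup>2 + (g x)\<^sup>2)"
    by simp
qed

lemma L2_add:
  assumes "f \<in> L2 M" "g \<in> L2 M"
  shows "(\<lambda>x. f x + g x) \<in> L2 M"
  using assms L2_mult_integrable[OF assms] by (auto simp: L2_def power2_sum mult.assoc)

lemma L2_scale: "f \<in> L2 M \<Longrightarrow> (\<lambda>x. a * f x) \<in> L2 M"
  by (auto simp: L2_def power_mult_distrib)

lemma L2_sum: "finite I \<Longrightarrow> (\<And>i. i \<in> I \<Longrightarrow> f i \<in> L2 M) \<Longrightarrow> (\<lambda>x. \<Sum>i\<in>I. f i x) \<in> L2 M"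
proof (induction I rule: finite_induct)
  case empty
  then show ?case by (simp add: L2_def)
next
  case (insert i I)
  then show ?case by (simp add: L2_add)
qed

lemma L2_diff: "f \<in> L2 M \<Longrightarrow> g \<in> L2 M \<Longrightarrow> (\<lambda>x. f x - g x) \<in> L2 M"
  using L2_add[of f M "\<lambda>x. - 1 * g x"] L2_scale[of g M "- 1"] by simp

lemma sum_fun_apply: "(\<Sum>i\<in>I. f i) x = (\<Sum>i\<in>I. f i x)" for f :: "'i \<Rightarrow> 'a \<Rightarrow> real"
  by (induction I rule: infinite_finite_induct) auto

lemma subspace_L2_orthogonal:
  assumes r: "r \<in> L2 M"
  shows "real_fun.subspace {h \<in> L2 M. L2_inner M r h = 0}"
proof (rule real_fun.subspaceI)
  show "0 \<in> {h \<in> L2 M. L2_inner M r h = 0}"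
    by (simp add: L2_def L2_inner_def zero_fun_def)
next
  fix f g assume "f \<in> {h \<in> L2 M. L2_inner M r h = 0}" "g \<in> {h \<in> L2 M. L2_inner M r h = 0}"
  then show "f + g \<in> {h \<in> L2 M. L2_inner M r h = 0}"
    using L2_add[of f M g] L2_mult_integrable[OF r, of f] L2_mult_integrable[OF r, of g]
    by (simp add: L2_inner_def plus_fun_def distrib_left)
next
  fix a f assume "f \<in> {h \<in> L2 M. L2_inner M r h = 0}"
  then show "(\<lambda>x. a * f x) \<in> {h \<in> L2 M. L2_inner M r h = 0}"
    using L2_scale[of f M a] by (simp add: L2_inner_def mult.left_commute)
qed

text \<open>
The residual of the Fourier sum is orthogonal to each member of the family, and the functions orthogonal to
the residual form a subspace, so the residual is orthogonal to the whole span.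
\<close>

lemma L2_projection_orthonormal:
  fixes e :: "'i::finite \<Rightarrow> 'a \<Rightarrow> real"
  assumes e: "L2_orthonormal M e" and c: "c \<in> L2 M"
  shows "is_L2_projection M (real_fun.span (range e)) c (\<lambda>x. \<Sum>i\<in>UNIV. L2_inner M c (e i) * e i x)"
proof -
  let ?g = "\<lambda>x. \<Sum>i\<in>UNIV. L2_inner M c (e i) * e i x"
  have eL2: "e i \<in> L2 M" for i
    using e by (simp add: L2_orthonormal_def)
  have g: "?g \<in> L2 M"
    by (intro L2_sum L2_scale eL2) simp
  have "(\<Sum>i\<in>UNIV. (\<lambda>x. L2_inner M c (e i) * e i x)) \<in> real_fun.span (range e)"
    by (intro real_fun.span_sum real_fun.span_scale real_fun.span_base) auto
  then have g_span: "?g \<in> real_fun.span (range e)"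
    by (simp add: sum_fun_apply[abs_def])
  have "L2_inner M (\<lambda>x. c x - ?g x) (e j) = 0" for j
  proof -
    have "L2_inner M (\<lambda>x. c x - ?g x) (e j)
        = (LINT x|M. c x * e j x - (\<Sum>i\<in>UNIV. L2_inner M c (e i) * (e i x * e j x)))"
      unfolding L2_inner_def by (simp add: algebra_simps sum_distrib_left)
    also have "\<dots> = L2_inner M c (e j) - (\<Sum>i\<in>UNIV. L2_inner M c (e i) * L2_inner M (e i) (e j))"
      unfolding L2_inner_def using L2_mult_integrable[OF c eL2] L2_mult_integrable[OF eL2 eL2] by simp
    also have "\<dots> = L2_inner M c (e j) - (\<Sum>i\<in>UNIV. if i = j then L2_inner M c (e i) else 0)"
      using e by (intro arg_cong2[where f = minus] refl sum.cong) (auto simp: L2_orthonormal_def)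
    also have "\<dots> = 0"
      by simp
    finally show ?thesis .
  qed
  then have "real_fun.span (range e) \<subseteq> {h \<in> L2 M. L2_inner M (\<lambda>x. c x - ?g x) h = 0}"
    using eL2 by (intro real_fun.span_minimal subspace_L2_orthogonal L2_diff c g) auto
  then show ?thesis
    using c g_span by (auto simp: is_L2_projection_def)
qed

lemma L2_tensor:
  assumes S: "S \<in> sets lebesgue" and T: "T \<in> sets lebesgue"
    and f: "f \<in> L2 (lebesgue_on S)" and g: "g \<in> L2 (lebesgue_on T)"
  shows "f \<otimes> g \<in> L2 (lebesgue_on (S \<times> T))"
proof -
  have "(\<lambda>z. f (fst z)) \<in> borel_measurable (lebesgue_on (S \<times> T))"
    "(\<lambda>z. g (snd z)) \<in> borel_measurable (lebesgue_on (S \<times> T))"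
    using measurable_compose[OF measurable_fst_lebesgue_on, of f S borel T]
      measurable_compose[OF measurable_snd_lebesgue_on, of g T borel S] f g
    by (simp_all add: L2_def)
  then have "f \<otimes> g \<in> borel_measurable (lebesgue_on (S \<times> T))"
    by (simp add: tensor_def split_beta)
  moreover have "integrable (lebesgue_on (S \<times> T)) ((\<lambda>x. (f x)\<^sup>2) \<otimes> (\<lambda>y. (g y)\<^sup>2))"
    using f g by (intro integrable_tensor S T) (auto simp: L2_def)
  ultimately show ?thesis
    by (simp add: L2_def tensor_def case_prod_unfold power_mult_distrib)
qed

lemma L2_orthonormal_tensor:
  assumes S: "S \<in> sets lebesgue" and T: "T \<in> sets lebesgue"
    and e: "L2_orthonormal (lebesgue_on S) e" and d: "L2_orthonormal (lebesgue_on T) d"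
  shows "L2_orthonormal (lebesgue_on (S \<times> T)) (\<lambda>(i, j). e i \<otimes> d j)"
proof -
  have "L2_inner (lebesgue_on (S \<times> T)) (e i \<otimes> d j) (e k \<otimes> d l) = (if (i, j) = (k, l) then 1 else 0)"
    for i j k l
  proof -
    have "L2_inner (lebesgue_on (S \<times> T)) (e i \<otimes> d j) (e k \<otimes> d l)
        = integral\<^sup>L (lebesgue_on (S \<times> T)) ((\<lambda>x. e i x * e k x) \<otimes> (\<lambda>y. d j y * d l y))"
      unfolding L2_inner_def by (intro Bochner_Integration.integral_cong) (auto simp: tensor_def)
    also have "\<dots> = L2_inner (lebesgue_on S) (e i) (e k) * L2_inner (lebesgue_on T) (d j) (d l)"
      unfolding L2_inner_def using e d
      by (intro integral_tensor S T L2_mult_integrable) (auto simp: L2_orthonormal_def)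
    finally show ?thesis
      using e d by (simp add: L2_orthonormal_def)
  qed
  then show ?thesis
    using L2_tensor[OF S T] e d by (auto simp: L2_orthonormal_def)
qed

section \<open>Integration against a copula density\<close>

text \<open>
The map \<open>q\<close> stands for either of the two coordinate projections. The margin is known as a measure on
Borel sets only, while \<open>h\<close> is Lebesgue measurable; the change of variables is therefore made for a Borel
version of \<open>h\<close>, and the condition on null sets carries the almost everywhere equality back to the square.
\<close>

lemma
  fixes c :: "real \<times> real \<Rightarrow> real" and q :: "real \<times> real \<Rightarrow> real"
  assumes c: "c \<in> borel_measurable (lebesgue_on unit_square)" "\<forall>z\<in>unit_square. 0 \<le> c z"
    and margin: "distr (density (lebesgue_on unit_square) (\<lambda>z. ennreal (c z))) borel q
      = uniform_measure lborel {0..1}"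
    and q: "q \<in> borel_measurable borel" "q \<in> unit_square \<rightarrow> {0..1}"
    and null: "\<And>N. N \<in> null_sets lborel \<Longrightarrow> q -` N \<in> null_sets lborel"
    and h: "integrable (lebesgue_on {0..1}) h"
  shows integrable_uniform_margin: "integrable (lebesgue_on unit_square) (\<lambda>z. c z * h (q z))"
    and integral_uniform_margin: "(LINT z|lebesgue_on unit_square. c z * h (q z)) = (LINT x|lebesgue_on {0..1}. h x)"
proof -
  let ?Q = "lebesgue_on unit_square" and ?I = "lebesgue_on {0..1::real}"
  have Q: "unit_square \<in> sets lebesgue"
    by (rule sets_lebesgue_Times) auto
  have I: "{0..1::real} \<in> sets lebesgue"
    by auto
  obtain g where g: "g \<in> borel_measurable borel" "AE x in ?I. h x = g x"
    by (rule borel_version_lebesgue_on[OF I borel_measurable_integrable[OF h]])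
  have gI: "g \<in> borel_measurable ?I"
    using g(1) by (intro measurable_restrict_space1) (simp add: measurable_completion)
  have int_g: "integrable ?I g"
    using integrable_cong_AE[OF borel_measurable_integrable[OF h] gI g(2)] h by simp
  have "uniform_measure lborel {0..1::real} = density lborel (\<lambda>x. ennreal (indicator {0..1} x))"
    unfolding uniform_measure_def by (intro density_cong) (auto simp: divide_ennreal_def ennreal_indicator)
  note U = margin[unfolded this]
  have q_meas: "q \<in> ?Q \<rightarrow>\<^sub>M ?I"
    by (rule measurable_lebesgue_on_vimage[OF q null])
  have qd: "q \<in> borel_measurable (density ?Q (\<lambda>z. ennreal (c z)))"
    using q(1) by (simp add: measurable_restrict_space1 measurable_completion)
  have cnn: "AE z in ?Q. 0 \<le> c z"
    using c(2) by (intro AE_I2) auto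
  have gq: "(\<lambda>z. g (q z)) \<in> borel_measurable ?Q"
    by (rule measurable_compose[OF q_meas gI])
  have hq: "(\<lambda>z. h (q z)) \<in> borel_measurable ?Q"
    by (rule measurable_compose[OF q_meas borel_measurable_integrable[OF h]])
  have ae: "AE z in ?Q. c z * g (q z) = c z * h (q z)"
    by (rule eventually_mono[OF AE_lebesgue_on_vimage[OF Q I q(2) null g(2)]]) auto
  have gl: "(\<lambda>x. indicator {0..1} x * g x) \<in> borel_measurable lborel"
    using g(1) by simp
  have cg: "integrable ?Q (\<lambda>z. c z * g (q z)) \<longleftrightarrow> integrable ?I g"
  proof -
    have "integrable ?Q (\<lambda>z. c z * g (q z)) \<longleftrightarrow> integrable (density ?Q (\<lambda>z. ennreal (c z))) (\<lambda>z. g (q z))"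
      using integrable_density[OF gq c(1) cnn] by simp
    also have "\<dots> \<longleftrightarrow> integrable (density lborel (\<lambda>x. ennreal (indicator {0..1} x))) g"
      using integrable_distr_eq[OF qd g(1)] by (simp add: U)
    also have "\<dots> \<longleftrightarrow> integrable lborel (\<lambda>x. indicator {0..1} x * g x)"
      using g(1) by (subst integrable_density) auto
    also have "\<dots> \<longleftrightarrow> integrable ?I g"
      using I gl by (simp add: integrable_restrict_space integrable_completion)
    finally show ?thesis .
  qed
  have Icg: "(LINT z|?Q. c z * g (q z)) = (LINT x|?I. g x)"
  proof -
    have "(LINT z|?Q. c z * g (q z)) = integral\<^sup>L (density ?Q (\<lambda>z. ennreal (c z))) (\<lambda>z. g (q z))"
      using integral_density[OF gq c(1) cnn] by simp
    also have "\<dots> = integral\<^sup>L (density lborel (\<lambda>x. ennreal (indicator {0..1} x))) g"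
      using integral_distr[OF qd g(1)] by (simp add: U)
    also have "\<dots> = integral\<^sup>L lborel (\<lambda>x. indicator {0..1} x * g x)"
      using g(1) by (subst integral_density) auto
    also have "\<dots> = (LINT x|?I. g x)"
      using I gl by (simp add: integral_restrict_space integral_completion)
    finally show ?thesis .
  qed
  show "integrable ?Q (\<lambda>z. c z * h (q z))"
    using cg int_g integrable_cong_AE[OF borel_measurable_times[OF c(1) gq] borel_measurable_times[OF c(1) hq] ae]
    by simp
  show "(LINT z|?Q. c z * h (q z)) = (LINT x|?I. h x)"
    using Icg integral_cong_AE[OF borel_measurable_times[OF c(1) gq] borel_measurable_times[OF c(1) hq] ae]
      integral_cong_AE[OF borel_measurable_integrable[OF h] gI g(2)]
    by simp
qed

lemma
  assumes c: "copula_density c" and h: "integrable (lebesgue_on {0..1}) h"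
  shows integrable_copula_fst: "integrable (lebesgue_on unit_square) (\<lambda>z. c z * h (fst z))"
    and integral_copula_fst: "(LINT z|lebesgue_on unit_square. c z * h (fst z)) = (LINT x|lebesgue_on {0..1}. h x)"
    and integrable_copula_snd: "integrable (lebesgue_on unit_square) (\<lambda>z. c z * h (snd z))"
    and integral_copula_snd: "(LINT z|lebesgue_on unit_square. c z * h (snd z)) = (LINT x|lebesgue_on {0..1}. h x)"
proof -
  have q: "fst \<in> borel_measurable (borel :: (real \<times> real) measure)"
    "snd \<in> borel_measurable (borel :: (real \<times> real) measure)"
    by (simp_all add: borel_prod[symmetric])
  have p: "fst \<in> unit_square \<rightarrow> {0..1::real}" "snd \<in> unit_square \<rightarrow> {0..1::real}"
    by auto
  note * = c[unfolded copula_density_def]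
  note f = *[THEN conjunct1] *[THEN conjunct2, THEN conjunct1]
    *[THEN conjunct2, THEN conjunct2, THEN conjunct1] q(1) p(1) null_sets_vimage_fst h
  note s = *[THEN conjunct1] *[THEN conjunct2, THEN conjunct1]
    *[THEN conjunct2, THEN conjunct2, THEN conjunct2] q(2) p(2) null_sets_vimage_snd h
  show "integrable (lebesgue_on unit_square) (\<lambda>z. c z * h (fst z))"
    by (rule integrable_uniform_margin[OF f])
  show "(LINT z|lebesgue_on unit_square. c z * h (fst z)) = (LINT x|lebesgue_on {0..1}. h x)"
    by (rule integral_uniform_margin[OF f])
  show "integrable (lebesgue_on unit_square) (\<lambda>z. c z * h (snd z))"
    by (rule integrable_uniform_margin[OF s])
  show "(LINT z|lebesgue_on unit_square. c z * h (snd z)) = (LINT x|lebesgue_on {0..1}. h x)"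
    by (rule integral_uniform_margin[OF s])
qed

section \<open>The projection as a Fourier sum and as an integral operator\<close>

lemma inner_matrix_vector_mult_sum:
  fixes A :: "real^'n^'m"
  shows "x \<bullet> (A *v y) = (\<Sum>i\<in>UNIV. \<Sum>j\<in>UNIV. A $ i $ j * (x $ i * y $ j))"
  by (simp add: inner_vec_def matrix_vector_mult_def sum_distrib_left ac_simps)

lemma coefficient_matrix_nth:
  "coefficient_matrix \<phi> c $ i $ j =
    L2_inner (lebesgue_on unit_square) c ((\<lambda>t. \<phi> t $ i) \<otimes> (\<lambda>t. \<phi> t $ j))"
  by (simp add: coefficient_matrix_def L2_inner_def tensor_def case_prod_unfold)

lemma copula_projection_tensor_expansion:
  "copula_projection \<phi> c =
    (\<lambda>z. \<Sum>p\<in>UNIV. L2_inner (lebesgue_on unit_square) c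
        ((\<lambda>(i, j). (\<lambda>t. \<phi> t $ i) \<otimes> (\<lambda>t. \<phi> t $ j)) p) *
      (\<lambda>(i, j). (\<lambda>t. \<phi> t $ i) \<otimes> (\<lambda>t. \<phi> t $ j)) p z)"
  unfolding copula_projection_def inner_matrix_vector_mult_sum coefficient_matrix_nth
    UNIV_Times_UNIV[symmetric] sum.cartesian_product'
  by (simp add: tensor_def fun_eq_iff)

lemma unit_interval_lebesgue: "{0..1::real} \<in> sets lebesgue"
  by simp

lemma copula_projection_is_L2_projection:
  fixes \<phi> :: "real \<Rightarrow> real^'p::finite"
  assumes orth: "L2_orthonormal (lebesgue_on {0..1}) (\<lambda>i t. \<phi> t $ i)"
    and c: "c \<in> L2 (lebesgue_on unit_square)"
  shows "is_L2_projection (lebesgue_on unit_square)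
      (real_fun.span {(\<lambda>t. \<phi> t $ i) \<otimes> (\<lambda>t. \<phi> t $ j) |i j. True}) c (copula_projection \<phi> c)"
proof -
  let ?e = "\<lambda>(i, j). (\<lambda>t. \<phi> t $ i) \<otimes> (\<lambda>t. \<phi> t $ j)"
  have "L2_orthonormal (lebesgue_on unit_square) ?e"
    using L2_orthonormal_tensor[OF unit_interval_lebesgue unit_interval_lebesgue orth orth] .
  from L2_projection_orthonormal[OF this c]
  have "is_L2_projection (lebesgue_on unit_square) (real_fun.span (range ?e)) c (copula_projection \<phi> c)"
    unfolding copula_projection_tensor_expansion .
  moreover have "range ?e = {(\<lambda>t. \<phi> t $ i) \<otimes> (\<lambda>t. \<phi> t $ j) |i j. True}"
    by auto
  ultimately show ?thesis
    by simp
qed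

lemma L2_inner_left:
  fixes \<phi> :: "real \<Rightarrow> real^'p::finite"
  assumes "L2_orthonormal M (\<lambda>i t. \<phi> t $ i)"
  shows "(\<lambda>x. a \<bullet> \<phi> x) \<in> L2 M"
  using assms unfolding inner_vec_def by (auto intro!: L2_sum L2_scale simp: L2_orthonormal_def)

lemma integral_inner_times_inner:
  fixes \<phi> :: "real \<Rightarrow> real^'p::finite"
  assumes orth: "L2_orthonormal M (\<lambda>i t. \<phi> t $ i)"
  shows "(LINT x|M. (a \<bullet> \<phi> x) * (b \<bullet> \<phi> x)) = a \<bullet> b"
proof -
  have int: "integrable M (\<lambda>x. \<phi> x $ i * \<phi> x $ j)" for i j
    using orth by (intro L2_mult_integrable) (auto simp: L2_orthonormal_def)
  have val: "(LINT x|M. \<phi> x $ i * \<phi> x $ j) = (if i = j then 1 else 0)" for i j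
    using orth by (auto simp: L2_orthonormal_def L2_inner_def)
  have "(LINT x|M. (a \<bullet> \<phi> x) * (b \<bullet> \<phi> x))
      = (LINT x|M. (\<Sum>i\<in>UNIV. \<Sum>j\<in>UNIV. (a $ i * b $ j) * (\<phi> x $ i * \<phi> x $ j)))"
    unfolding inner_vec_def sum_product
    by (intro Bochner_Integration.integral_cong sum.cong refl) (simp add: mult_ac)
  also have "\<dots> = (\<Sum>i\<in>UNIV. \<Sum>j\<in>UNIV. (a $ i * b $ j) * (if i = j then 1 else 0))"
    using int by (simp add: val)
  also have "\<dots> = a \<bullet> b"
    by (simp add: inner_vec_def if_distrib cong: if_cong)
  finally show ?thesis .
qed

text \<open>
The projection is the integral operator with kernel \<open>(\<phi> u \<bullet> \<phi> x) (\<phi> v \<bullet> \<phi> y)\<close>. In this form the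
sign of the projection can be read off from the sign of \<open>\<phi> u \<bullet> \<phi> v\<close>.
\<close>

lemma
  fixes \<phi> :: "real \<Rightarrow> real^'p::finite"
  assumes orth: "L2_orthonormal (lebesgue_on {0..1}) (\<lambda>i t. \<phi> t $ i)"
    and c: "c \<in> L2 (lebesgue_on unit_square)"
  shows integrable_copula_projection_kernel:
      "integrable (lebesgue_on unit_square) (\<lambda>z. c z * ((\<phi> u \<bullet> \<phi> (fst z)) * (\<phi> v \<bullet> \<phi> (snd z))))"
    and copula_projection_kernel: "copula_projection \<phi> c (u, v) =
      (LINT z|lebesgue_on unit_square. c z * ((\<phi> u \<bullet> \<phi> (fst z)) * (\<phi> v \<bullet> \<phi> (snd z))))"
proof -
  let ?Q = "lebesgue_on unit_square"
  have "(\<lambda>x. \<phi> u \<bullet> \<phi> x) \<otimes> (\<lambda>x. \<phi> v \<bullet> \<phi> x) \<in> L2 ?Q"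
    by (intro L2_tensor unit_interval_lebesgue L2_inner_left orth)
  from L2_mult_integrable[OF c this]
  show "integrable ?Q (\<lambda>z. c z * ((\<phi> u \<bullet> \<phi> (fst z)) * (\<phi> v \<bullet> \<phi> (snd z))))"
    by (simp add: tensor_def case_prod_unfold)
  have "(\<lambda>t. \<phi> t $ i) \<otimes> (\<lambda>t. \<phi> t $ j) \<in> L2 ?Q" for i j
    using orth by (intro L2_tensor unit_interval_lebesgue) (auto simp: L2_orthonormal_def)
  from L2_mult_integrable[OF c this]
  have int: "integrable ?Q (\<lambda>z. c z * (\<phi> (fst z) $ i * \<phi> (snd z) $ j))" for i j
    by (simp add: tensor_def case_prod_unfold)
  have "(LINT z|?Q. c z * ((\<phi> u \<bullet> \<phi> (fst z)) * (\<phi> v \<bullet> \<phi> (snd z))))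
      = (LINT z|?Q. (\<Sum>i\<in>UNIV. \<Sum>j\<in>UNIV. (\<phi> u $ i * \<phi> v $ j) * (c z * (\<phi> (fst z) $ i * \<phi> (snd z) $ j))))"
    unfolding inner_vec_def sum_product unfolding sum_distrib_left
    by (intro Bochner_Integration.integral_cong sum.cong refl) (simp add: mult_ac)
  also have "\<dots> = (\<Sum>i\<in>UNIV. \<Sum>j\<in>UNIV. (\<phi> u $ i * \<phi> v $ j) * (LINT z|?Q. c z * (\<phi> (fst z) $ i * \<phi> (snd z) $ j)))"
    using int by simp
  also have "\<dots> = copula_projection \<phi> c (u, v)"
    unfolding copula_projection_def inner_matrix_vector_mult_sum prod.case
    by (intro sum.cong refl) (simp add: coefficient_matrix_def case_prod_unfold)
  finally show "copula_projection \<phi> c (u, v) =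
      (LINT z|?Q. c z * ((\<phi> u \<bullet> \<phi> (fst z)) * (\<phi> v \<bullet> \<phi> (snd z))))" ..
qed

lemma copula_projection_nonneg:
  fixes \<phi> :: "real \<Rightarrow> real^'p::finite"
  assumes orth: "L2_orthonormal (lebesgue_on {0..1}) (\<lambda>i t. \<phi> t $ i)"
    and c: "c \<in> L2 (lebesgue_on unit_square)" "\<And>z. z \<in> unit_square \<Longrightarrow> 0 \<le> c z"
    and pos: "\<And>x y. x \<in> {0..1} \<Longrightarrow> y \<in> {0..1} \<Longrightarrow> 0 \<le> \<phi> x \<bullet> \<phi> y"
    and uv: "u \<in> {0..1}" "v \<in> {0..1}"
  shows "0 \<le> copula_projection \<phi> c (u, v)"
  unfolding copula_projection_kernel[OF orth c(1)]
  using c(2) pos uv by (intro Bochner_Integration.integral_nonneg) (auto intro!: mult_nonneg_nonneg)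

text \<open>
Since the component \<open>k\<close> of \<open>\<phi>\<close> is constant, the entries in question are integrals of a single component
against one margin of \<open>c\<close>, that is, inner products of this component with the constant function.
\<close>

lemma coefficient_matrix_copula_axis:
  fixes \<phi> :: "real \<Rightarrow> real^'p::finite"
  assumes orth: "L2_orthonormal (lebesgue_on {0..1}) (\<lambda>i t. \<phi> t $ i)"
    and k: "\<forall>t\<in>{0..1}. \<phi> t $ k = 1"
    and c: "copula_density c"
  shows "coefficient_matrix \<phi> c *v axis k 1 = axis k 1"
    and "transpose (coefficient_matrix \<phi> c) *v axis k 1 = axis k 1"
proof -
  let ?I = "lebesgue_on {0..1::real}" and ?Q = "lebesgue_on unit_square"
  have eq: "(LINT x|?I. \<phi> x $ i) = (LINT x|?I. \<phi> x $ i * \<phi> x $ k)" for i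
    using k by (intro Bochner_Integration.integral_cong) auto
  have int: "integrable ?I (\<lambda>x. \<phi> x $ i)" for i
  proof -
    have "integrable ?I (\<lambda>x. \<phi> x $ i * \<phi> x $ k)"
      using orth by (intro L2_mult_integrable) (auto simp: L2_orthonormal_def)
    then show ?thesis
      using k by (subst Bochner_Integration.integrable_cong[OF refl, where g = "\<lambda>x. \<phi> x $ i * \<phi> x $ k"]) auto
  qed
  have val: "(LINT x|?I. \<phi> x $ i) = (if i = k then 1 else 0)" for i
    unfolding eq using orth by (auto simp: L2_orthonormal_def L2_inner_def)
  have "coefficient_matrix \<phi> c $ i $ k = (LINT z|?Q. c z * \<phi> (fst z) $ i)" for i
    unfolding coefficient_matrix_def using k
    by (auto simp: case_prod_unfold intro!: Bochner_Integration.integral_cong)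
  then have col: "coefficient_matrix \<phi> c $ i $ k = (if i = k then 1 else 0)" for i
    using integral_copula_fst[OF c int, of i] val by simp
  have "coefficient_matrix \<phi> c $ k $ i = (LINT z|?Q. c z * \<phi> (snd z) $ i)" for i
    unfolding coefficient_matrix_def using k
    by (auto simp: case_prod_unfold intro!: Bochner_Integration.integral_cong)
  then have row: "coefficient_matrix \<phi> c $ k $ i = (if i = k then 1 else 0)" for i
    using integral_copula_snd[OF c int, of i] val by simp
  show "coefficient_matrix \<phi> c *v axis k 1 = axis k 1"
    unfolding matrix_vector_mult_basis using col by (simp add: vec_eq_iff column_def axis_def)
  show "transpose (coefficient_matrix \<phi> c) *v axis k 1 = axis k 1"
    unfolding matrix_vector_mult_basis using row by (simp add: vec_eq_iff column_def axis_def transpose_def)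
qed

text \<open>
The sum of the two projections symmetrises the kernel, which is what turns the deviation from
\<open>2 (\<phi> u \<bullet> \<phi> v)\<close> into a product of differences and makes it quadratic in \<open>\<phi> x - \<phi> y\<close>. The deviation
is then bounded by a function of \<open>x\<close> plus the same function of \<open>y\<close>, and the margins integrate both.
\<close>

lemma copula_projection_le_inner:
  fixes \<phi> F :: "real \<Rightarrow> real^'p::finite"
  assumes orth: "L2_orthonormal (lebesgue_on {0..1}) (\<lambda>i t. \<phi> t $ i)"
    and c: "c \<in> L2 (lebesgue_on unit_square)" "copula_density c"
    and supp: "\<And>z. z \<in> unit_square \<Longrightarrow> c z \<noteq> 0 \<Longrightarrow> F (fst z) = F (snd z)"
    and r: "integrable (lebesgue_on {0..1}) (\<lambda>x. (norm (\<phi> x - F x))\<^sup>2)"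
  shows "copula_projection \<phi> c (u, v) + copula_projection \<phi> c (v, u)
    \<le> 2 * (\<phi> u \<bullet> \<phi> v) + 4 * (norm (\<phi> u) * norm (\<phi> v)) * (LINT x|lebesgue_on {0..1}. (norm (\<phi> x - F x))\<^sup>2)"
proof -
  let ?I = "lebesgue_on {0..1::real}" and ?Q = "lebesgue_on unit_square"
  define s t where "s x = \<phi> u \<bullet> \<phi> x" and "t x = \<phi> v \<bullet> \<phi> x" for x
  define N where "N = norm (\<phi> u) * norm (\<phi> v)"
  define R where "R x = (norm (\<phi> x - F x))\<^sup>2" for x
  define h where "h x = s x * t x + 2 * N * R x" for x
  have N: "0 \<le> N"
    by (simp add: N_def)
  have st: "integrable ?I (\<lambda>x. s x * t x)"
    unfolding s_def t_def by (intro L2_mult_integrable L2_inner_left orth)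
  have R: "integrable ?I R"
    using r by (simp add: R_def[abs_def])
  have h: "integrable ?I h"
    unfolding h_def[abs_def] using st R by (intro Bochner_Integration.integrable_add integrable_mult_right) auto
  have pointwise: "s x * t y + t x * s y \<le> h x + h y" if F: "F x = F y" for x y
  proof -
    have "norm (\<phi> x - \<phi> y) \<le> norm (\<phi> x - F x) + norm (\<phi> y - F y)"
      using norm_triangle_ineq4[of "\<phi> x - F x" "\<phi> y - F y"] F by simp
    then have "(norm (\<phi> x - \<phi> y))\<^sup>2 \<le> (norm (\<phi> x - F x) + norm (\<phi> y - F y))\<^sup>2"
      by (simp add: power_mono)
    also have "\<dots> \<le> 2 * R x + 2 * R y"
      using sum_squares_bound[of "norm (\<phi> x - F x)" "norm (\<phi> y - F y)"] by (simp add: R_def power2_sum)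
    finally have d: "(norm (\<phi> x - \<phi> y))\<^sup>2 \<le> 2 * R x + 2 * R y" .
    \<comment> \<open>The error term is controlled by Cauchy--Schwarz, as \<open>s\<close> and \<open>t\<close> are linear in \<open>\<phi>\<close>.\<close>
    have "- ((s x - s y) * (t x - t y)) \<le> \<bar>s x - s y\<bar> * \<bar>t x - t y\<bar>"
      by (metis abs_ge_minus_self abs_mult)
    also have "\<dots> \<le> (norm (\<phi> u) * norm (\<phi> x - \<phi> y)) * (norm (\<phi> v) * norm (\<phi> x - \<phi> y))"
      unfolding s_def t_def inner_diff_right[symmetric]
      by (intro mult_mono Cauchy_Schwarz_ineq2) auto
    also have "\<dots> = N * (norm (\<phi> x - \<phi> y))\<^sup>2"
      by (simp add: N_def power2_eq_square)
    also have "\<dots> \<le> N * (2 * R x + 2 * R y)"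
      using d N by (rule mult_left_mono)
    finally show ?thesis
      by (simp add: h_def algebra_simps)
  qed
  have ker: "integrable ?Q (\<lambda>z. c z * (s (fst z) * t (snd z)))" "integrable ?Q (\<lambda>z. c z * (t (fst z) * s (snd z)))"
    unfolding s_def t_def by (intro integrable_copula_projection_kernel orth c)+
  have "copula_projection \<phi> c (u, v) + copula_projection \<phi> c (v, u)
      = (LINT z|?Q. c z * (s (fst z) * t (snd z)) + c z * (t (fst z) * s (snd z)))"
    using ker by (simp add: copula_projection_kernel[OF orth c(1)] s_def t_def)
  also have "\<dots> \<le> (LINT z|?Q. c z * h (fst z) + c z * h (snd z))"
  proof (rule integral_mono)
    fix z assume "z \<in> space ?Q"
    then have z: "z \<in> unit_square"
      by simp
    then have "0 \<le> c z"
      using c(2) by (auto simp: copula_density_def)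
    show "c z * (s (fst z) * t (snd z)) + c z * (t (fst z) * s (snd z)) \<le> c z * h (fst z) + c z * h (snd z)"
    proof (cases "c z = 0")
      case False
      then show ?thesis
        using mult_left_mono[OF pointwise[OF supp[OF z False]] \<open>0 \<le> c z\<close>] by (simp add: distrib_left)
    qed simp
  qed (use ker integrable_copula_fst[OF c(2) h] integrable_copula_snd[OF c(2) h] in auto)
  also have "\<dots> = 2 * (LINT x|?I. h x)"
    using integrable_copula_fst[OF c(2) h] integrable_copula_snd[OF c(2) h]
      integral_copula_fst[OF c(2) h] integral_copula_snd[OF c(2) h] by simp
  also have "(LINT x|?I. h x) = \<phi> u \<bullet> \<phi> v + 2 * N * (LINT x|?I. R x)"
    unfolding h_def using st R integral_inner_times_inner[OF orth, of "\<phi> u" "\<phi> v"] by (simp add: s_def t_def)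
  finally show ?thesis
    by (simp add: N_def R_def algebra_simps)
qed

section \<open>Block densities along the fibres of a simple function\<close>

text \<open>
The density is constant on each square \<open>B \<times> B\<close> over a fibre \<open>B\<close> of \<open>F\<close>, with total mass \<open>|B|\<close>
there, and vanishes off these squares. On fibres of measure zero the value is \<open>1 / 0 = 0\<close>.
\<close>

definition block_density :: "(real \<Rightarrow> 'b) \<Rightarrow> real \<times> real \<Rightarrow> real" where
  "block_density F z =
    (if F (fst z) = F (snd z)
     then 1 / measure (lebesgue_on {0..1}) (F -` {F (fst z)} \<inter> {0..1}) else 0)"

lemma block_density_eq_sum:
  assumes fin: "finite (F ` {0..1})" and z: "z \<in> unit_square"
  shows "block_density F z = (\<Sum>v\<in>F ` {0..1}. 1 / measure (lebesgue_on {0..1}) (F -` {v} \<inter> {0..1}) *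
    (indicator (F -` {v} \<inter> {0..1}) \<otimes> indicator (F -` {v} \<inter> {0..1})) z)"
proof -
  obtain x y where xy: "z = (x, y)" "x \<in> {0..1}" "y \<in> {0..1}"
    using z by auto
  have "(\<Sum>v\<in>F ` {0..1}. 1 / measure (lebesgue_on {0..1}) (F -` {v} \<inter> {0..1}) *
      (indicator (F -` {v} \<inter> {0..1}) \<otimes> indicator (F -` {v} \<inter> {0..1})) z)
    = (\<Sum>v\<in>F ` {0..1}. if v = F x then block_density F z else 0)"
    using xy by (intro sum.cong refl) (auto simp: block_density_def tensor_def indicator_def)
  also have "\<dots> = block_density F z"
    using fin xy by simp
  finally show ?thesis ..
qed

text \<open>
On the square a block density is a finite combination of tensor products of indicators. Rectangles are all
that the margins require: a margin evaluates the mass of \<open>A \<times> [0, 1]\<close> or of \<open>[0, 1] \<times> A\<close>.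
\<close>

lemma
  fixes F :: "real \<Rightarrow> 'b"
  assumes F: "simple_function (lebesgue_on {0..1}) F"
    and A: "A \<in> sets (lebesgue_on {0..1})" and B: "B \<in> sets (lebesgue_on {0..1})"
  shows integrable_block_density_Times: "integrable (lebesgue_on unit_square) (\<lambda>z. block_density F z * indicator (A \<times> B) z)"
    and integral_block_density_Times: "(LINT z|lebesgue_on unit_square. block_density F z * indicator (A \<times> B) z) =
      (\<Sum>v\<in>F ` {0..1}. measure (lebesgue_on {0..1}) (F -` {v} \<inter> A) * measure (lebesgue_on {0..1}) (F -` {v} \<inter> B)
        / measure (lebesgue_on {0..1}) (F -` {v} \<inter> {0..1}))"
proof -
  let ?I = "lebesgue_on {0..1::real}" and ?Q = "lebesgue_on unit_square"
  interpret finite_measure ?I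
    by (rule finite_measure_lebesgue_on) auto
  have fin: "finite (F ` {0..1})"
    using simple_functionD(1)[OF F] by simp
  have sub: "A \<subseteq> {0..1}" "B \<subseteq> {0..1}"
    using sets.sets_into_space[OF A] sets.sets_into_space[OF B] by auto
  have fibre: "F -` {v} \<inter> C \<in> sets ?I" if "C \<in> sets ?I" for v C
  proof -
    have "F -` {v} \<inter> C = (F -` {v} \<inter> space ?I) \<inter> C"
      using sets.sets_into_space[OF that] by auto
    then show ?thesis
      using simple_functionD(2)[OF F, of "{v}"] that by auto
  qed
  define w where "w v = 1 / measure ?I (F -` {v} \<inter> {0..1})" for v
  define \<tau> :: "'b \<Rightarrow> real \<times> real \<Rightarrow> real"
    where "\<tau> v = indicator (F -` {v} \<inter> A) \<otimes> indicator (F -` {v} \<inter> B)" for v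
  have ind: "integrable ?I (indicator (F -` {v} \<inter> C) :: real \<Rightarrow> real)" if "C \<in> sets ?I" for v C
    by (intro integrable_real_indicator fibre that) (simp add: emeasure_eq_measure)
  have int: "integrable ?Q (\<tau> v)" for v
    unfolding \<tau>_def by (intro integrable_tensor ind A B) simp_all
  have val: "integral\<^sup>L ?Q (\<tau> v) = measure ?I (F -` {v} \<inter> A) * measure ?I (F -` {v} \<inter> B)" for v
  proof -
    have "integral\<^sup>L ?Q (\<tau> v) = integral\<^sup>L ?I (indicator (F -` {v} \<inter> A)) * integral\<^sup>L ?I (indicator (F -` {v} \<inter> B))"
      unfolding \<tau>_def by (intro integral_tensor ind A B) simp_all
    moreover have "F -` {v} \<inter> A \<inter> {0..1} = F -` {v} \<inter> A" "F -` {v} \<inter> B \<inter> {0..1} = F -` {v} \<inter> B"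
      using sub by auto
    ultimately show ?thesis
      by simp
  qed
  have eq: "block_density F z * indicator (A \<times> B) z = (\<Sum>v\<in>F ` {0..1}. w v * \<tau> v z)" if "z \<in> space ?Q" for z
  proof -
    have "z \<in> unit_square"
      using that by simp
    then show ?thesis
      unfolding block_density_eq_sum[OF fin \<open>z \<in> unit_square\<close>] sum_distrib_right
      by (intro sum.cong refl) (auto simp: w_def \<tau>_def tensor_def indicator_def)
  qed
  show "integrable ?Q (\<lambda>z. block_density F z * indicator (A \<times> B) z)"
    using int by (subst Bochner_Integration.integrable_cong[OF refl eq]) auto
  have "(LINT z|?Q. block_density F z * indicator (A \<times> B) z) = (\<Sum>v\<in>F ` {0..1}. w v * integral\<^sup>L ?Q (\<tau> v))"
    using int by (subst Bochner_Integration.integral_cong[OF refl eq]) auto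
  then show "(LINT z|?Q. block_density F z * indicator (A \<times> B) z) =
      (\<Sum>v\<in>F ` {0..1}. measure ?I (F -` {v} \<inter> A) * measure ?I (F -` {v} \<inter> B)
        / measure ?I (F -` {v} \<inter> {0..1}))"
    by (simp add: val w_def)
qed

text \<open>
A fibre of measure zero contributes nothing on either side, so dividing by its measure does no harm. The
left-hand side is the mass that the block density gives to \<open>A \<times> [0, 1]\<close>.
\<close>

lemma sum_measure_fibres:
  fixes F :: "real \<Rightarrow> 'b"
  assumes F: "simple_function (lebesgue_on {0..1}) F" and A: "A \<in> sets (lebesgue_on {0..1})"
  shows "(\<Sum>v\<in>F ` {0..1}. measure (lebesgue_on {0..1}) (F -` {v} \<inter> A) * measure (lebesgue_on {0..1}) (F -` {v} \<inter> {0..1})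
        / measure (lebesgue_on {0..1}) (F -` {v} \<inter> {0..1})) = measure (lebesgue_on {0..1}) A"
proof -
  let ?I = "lebesgue_on {0..1::real}"
  interpret finite_measure ?I
    by (rule finite_measure_lebesgue_on) auto
  have sub: "A \<subseteq> {0..1}"
    using sets.sets_into_space[OF A] by auto
  have fibre: "F -` {v} \<inter> {0..1} \<in> sets ?I" for v
    using simple_functionD(2)[OF F, of "{v}"] by simp
  have fibreA: "F -` {v} \<inter> A \<in> sets ?I" for v
  proof -
    have "F -` {v} \<inter> A = (F -` {v} \<inter> {0..1}) \<inter> A"
      using sub by auto
    then show ?thesis
      using sets.Int[OF fibre A] by simp
  qed
  have "measure ?I (F -` {v} \<inter> A) * measure ?I (F -` {v} \<inter> {0..1}) / measure ?I (F -` {v} \<inter> {0..1})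
      = measure ?I (F -` {v} \<inter> A)" for v
  proof (cases "measure ?I (F -` {v} \<inter> {0..1}) = 0")
    case True
    have "measure ?I (F -` {v} \<inter> A) \<le> measure ?I (F -` {v} \<inter> {0..1})"
      using sub fibre by (intro finite_measure_mono) auto
    then show ?thesis
      using True measure_nonneg[of ?I "F -` {v} \<inter> A"] by simp
  qed simp
  then have "(\<Sum>v\<in>F ` {0..1}. measure ?I (F -` {v} \<inter> A) * measure ?I (F -` {v} \<inter> {0..1})
        / measure ?I (F -` {v} \<inter> {0..1})) = (\<Sum>v\<in>F ` {0..1}. measure ?I (F -` {v} \<inter> A))"
    by simp
  also have "\<dots> = measure ?I (\<Union>v\<in>F ` {0..1}. F -` {v} \<inter> A)"
    using simple_functionD(1)[OF F] fibreA
    by (intro finite_measure_finite_Union[symmetric]) (auto simp: disjoint_family_on_def)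
  also have "(\<Union>v\<in>F ` {0..1}. F -` {v} \<inter> A) = A"
    using sub by auto
  finally show ?thesis .
qed

lemma block_density_nonneg: "0 \<le> block_density F z"
  by (simp add: block_density_def)

lemma block_density_measurable:
  assumes F: "simple_function (lebesgue_on {0..1}) F"
  shows "block_density F \<in> borel_measurable (lebesgue_on unit_square)"
proof -
  have "integrable (lebesgue_on unit_square) (\<lambda>z. block_density F z * indicator ({0..1} \<times> {0..1}) z)"
    by (intro integrable_block_density_Times F) auto
  then show ?thesis
    by (intro measurable_cong[THEN iffD1, OF _ borel_measurable_integrable]) simp_all
qed

lemma copula_density_block_density:
  assumes F: "simple_function (lebesgue_on {0..1}) F"
  shows "copula_density (block_density F)"
proof -
  let ?I = "lebesgue_on {0..1::real}" and ?Q = "lebesgue_on unit_square"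
  let ?D = "density ?Q (\<lambda>z. ennreal (block_density F z))"
  interpret finite_measure ?I
    by (rule finite_measure_lebesgue_on) auto
  have meas: "block_density F \<in> borel_measurable ?Q"
    by (rule block_density_measurable[OF F])
  have "fst \<in> borel_measurable (borel :: (real \<times> real) measure)"
    "snd \<in> borel_measurable (borel :: (real \<times> real) measure)"
    by (simp_all add: borel_prod[symmetric])
  then have q: "fst \<in> borel_measurable ?D" "snd \<in> borel_measurable ?D"
    by (simp_all add: measurable_restrict_space1 measurable_completion)
  have full: "{0..1} \<in> sets ?I"
    by simp
  have box: "emeasure ?D (A \<times> B) = ennreal (LINT z|?Q. block_density F z * indicator (A \<times> B) z)"
    if "A \<in> sets ?I" "B \<in> sets ?I" for A B
  proof -
    have "A \<times> B = (fst -` A \<inter> space ?Q) \<inter> (snd -` B \<inter> space ?Q)"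
      using sets.sets_into_space[OF that(1)] sets.sets_into_space[OF that(2)] by auto
    then have "A \<times> B \<in> sets ?Q"
      using sets.Int[OF measurable_sets[OF measurable_fst_lebesgue_on that(1)]
          measurable_sets[OF measurable_snd_lebesgue_on that(2)]] by (simp only:)
    then have "emeasure ?D (A \<times> B) = (\<integral>\<^sup>+z. ennreal (block_density F z * indicator (A \<times> B) z) \<partial>?Q)"
      using meas that by (simp add: emeasure_density ennreal_mult' ennreal_indicator block_density_nonneg)
    also have "\<dots> = ennreal (LINT z|?Q. block_density F z * indicator (A \<times> B) z)"
      using integrable_block_density_Times[OF F that(1,2)]
      by (intro nn_integral_eq_integral) (auto simp: block_density_nonneg)
    finally show ?thesis .
  qed
  have AI: "A \<inter> {0..1} \<in> sets ?I" if "A \<in> sets borel" for A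
    using that by (intro sets_restrict_space_iff[THEN iffD2]) auto
  have unif: "ennreal (measure ?I (A \<inter> {0..1})) = emeasure (uniform_measure lborel {0..1}) A" if "A \<in> sets borel" for A
  proof -
    have "ennreal (measure ?I (A \<inter> {0..1})) = emeasure ?I (A \<inter> {0..1})"
      by (simp add: emeasure_eq_measure)
    also have "\<dots> = emeasure lborel (A \<inter> {0..1})"
      using that by (simp add: emeasure_restrict_space)
    finally show ?thesis
      using that by (simp add: Int_commute divide_ennreal_def)
  qed
  have boxes: "fst -` A \<inter> space ?Q = (A \<inter> {0..1}) \<times> {0..1}" "snd -` A \<inter> space ?Q = {0..1} \<times> (A \<inter> {0..1})" for A
    by auto
  have "distr ?D borel fst = uniform_measure lborel {0..1}"
  proof (rule measure_eqI)
    fix A assume "A \<in> sets (distr ?D borel fst)"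
    then have A: "A \<in> sets borel"
      by simp
    have "emeasure (distr ?D borel fst) A = emeasure ?D ((A \<inter> {0..1}) \<times> {0..1})"
      unfolding emeasure_distr[OF q(1) A] space_density boxes(1) ..
    also have "\<dots> = ennreal (LINT z|?Q. block_density F z * indicator ((A \<inter> {0..1}) \<times> {0..1}) z)"
      using A by (intro box AI full)
    also have "(LINT z|?Q. block_density F z * indicator ((A \<inter> {0..1}) \<times> {0..1}) z) = measure ?I (A \<inter> {0..1})"
      unfolding integral_block_density_Times[OF F AI[OF A] full] by (rule sum_measure_fibres[OF F AI[OF A]])
    also have "ennreal \<dots> = emeasure (uniform_measure lborel {0..1}) A"
      by (rule unif[OF A])
    finally show "emeasure (distr ?D borel fst) A = emeasure (uniform_measure lborel {0..1}) A" .
  qed simp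
  moreover have "distr ?D borel snd = uniform_measure lborel {0..1}"
  proof (rule measure_eqI)
    fix A assume "A \<in> sets (distr ?D borel snd)"
    then have A: "A \<in> sets borel"
      by simp
    have "emeasure (distr ?D borel snd) A = emeasure ?D ({0..1} \<times> (A \<inter> {0..1}))"
      unfolding emeasure_distr[OF q(2) A] space_density boxes(2) ..
    also have "\<dots> = ennreal (LINT z|?Q. block_density F z * indicator ({0..1} \<times> (A \<inter> {0..1})) z)"
      using A by (intro box AI full)
    also have "(LINT z|?Q. block_density F z * indicator ({0..1} \<times> (A \<inter> {0..1})) z) = measure ?I (A \<inter> {0..1})"
      unfolding integral_block_density_Times[OF F full AI[OF A]] sum_measure_fibres[OF F AI[OF A], symmetric]
      by (intro sum.cong refl) (simp add: mult.commute)
    also have "ennreal \<dots> = emeasure (uniform_measure lborel {0..1}) A"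
      by (rule unif[OF A])
    finally show "emeasure (distr ?D borel snd) A = emeasure (uniform_measure lborel {0..1}) A" .
  qed simp
  ultimately show ?thesis
    using meas by (simp add: copula_density_def block_density_nonneg)
qed

lemma block_density_L2:
  assumes F: "simple_function (lebesgue_on {0..1}) F"
  shows "block_density F \<in> L2 (lebesgue_on unit_square)"
proof -
  let ?I = "lebesgue_on {0..1::real}" and ?Q = "lebesgue_on unit_square"
  have "unit_square = cbox (0, 0) (1, 1)"
    by (simp add: cbox_Pair_eq)
  then have "unit_square \<in> lmeasurable"
    by (simp only: lmeasurable_cbox)
  then interpret finite_measure ?Q
    by (rule finite_measure_lebesgue_on)
  define K where "K = (\<Sum>v\<in>F ` {0..1}. 1 / measure ?I (F -` {v} \<inter> {0..1}))"
  have fin: "finite (F ` {0..1})"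
    using simple_functionD(1)[OF F] by simp
  have bound: "block_density F z \<le> K" if "z \<in> unit_square" for z
  proof -
    have "1 / measure ?I (F -` {F (fst z)} \<inter> {0..1}) \<le> K"
      unfolding K_def using that fin
      by (intro member_le_sum[where f = "\<lambda>v. 1 / measure ?I (F -` {v} \<inter> {0..1})"]) auto
    moreover have "0 \<le> K"
      unfolding K_def by (intro sum_nonneg) simp
    ultimately show ?thesis
      unfolding block_density_def by (auto simp only: split: if_split)
  qed
  have "integrable ?Q (\<lambda>z. (block_density F z)\<^sup>2)"
    using block_density_measurable[OF F] bound
    by (intro integrable_const_bound[where B = "K\<^sup>2"] AE_I2) (auto intro!: power_mono simp: block_density_nonneg)
  then show ?thesis
    using block_density_measurable[OF F] by (simp add: L2_def)
qed

section \<open>Passage to the diagonal\<close>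

text \<open>
Some simple functions converge to \<open>\<phi>\<close> pointwise with norm at most twice that of \<open>\<phi>\<close>; dominated convergence with
the bound \<open>(3 |\<phi>|)\<^sup>2\<close> does the rest.
\<close>

lemma simple_functions_approximate_L2:
  fixes \<phi> :: "real \<Rightarrow> real^'p::finite"
  assumes orth: "L2_orthonormal M (\<lambda>i t. \<phi> t $ i)"
  obtains F where "\<And>n. simple_function M (F n)"
    "\<And>n. integrable M (\<lambda>x. (norm (\<phi> x - F n x))\<^sup>2)"
    "(\<lambda>n. LINT x|M. (norm (\<phi> x - F n x))\<^sup>2) \<longlonglongrightarrow> 0"
proof -
  have comp: "(\<lambda>t. \<phi> t $ i) \<in> L2 M" for i
    using orth by (simp add: L2_orthonormal_def)
  then have meas: "\<phi> \<in> borel_measurable M"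
    by (intro borel_measurable_euclidean_space[THEN iffD2]) (auto simp: Basis_vec_def inner_axis L2_def)
  obtain F where approx: "(\<forall>n. simple_function M (F n)) \<and>
      (\<forall>x\<in>space M. (\<lambda>n. F n x) \<longlonglongrightarrow> \<phi> x) \<and>
      (\<forall>n. \<forall>x\<in>space M. dist (F n x) 0 \<le> 2 * dist (\<phi> x) 0)"
    by (rule exE[OF borel_measurable_implies_sequence_metric[OF meas, of 0]])
  then have F: "simple_function M (F n)"
    "x \<in> space M \<Longrightarrow> (\<lambda>n. F n x) \<longlonglongrightarrow> \<phi> x"
    "x \<in> space M \<Longrightarrow> dist (F n x) 0 \<le> 2 * dist (\<phi> x) 0" for n x
    by simp_all
  have F_meas: "F n \<in> borel_measurable M" for n
    by (rule borel_measurable_simple_function[OF F(1)])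
  have "integrable M (\<lambda>x. \<Sum>i\<in>UNIV. (\<phi> x $ i)\<^sup>2)"
    using comp by (simp add: L2_def)
  moreover have "(norm (\<phi> x))\<^sup>2 = (\<Sum>i\<in>UNIV. (\<phi> x $ i)\<^sup>2)" for x
    unfolding power2_norm_eq_inner inner_vec_def by (simp add: power2_eq_square)
  ultimately have dom: "integrable M (\<lambda>x. 9 * (norm (\<phi> x))\<^sup>2)"
    by simp
  have bound: "norm ((norm (\<phi> x - F n x))\<^sup>2) \<le> 9 * (norm (\<phi> x))\<^sup>2" if "x \<in> space M" for n x
  proof -
    have "norm (\<phi> x - F n x) \<le> 3 * norm (\<phi> x)"
      using norm_triangle_ineq4[of "\<phi> x" "F n x"] F(3)[OF that, of n] by simp
    then have "(norm (\<phi> x - F n x))\<^sup>2 \<le> (3 * norm (\<phi> x))\<^sup>2"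
      by (intro power_mono) auto
    then show ?thesis
      by (simp add: power_mult_distrib)
  qed
  have lim: "(\<lambda>n. (norm (\<phi> x - F n x))\<^sup>2) \<longlonglongrightarrow> 0" if "x \<in> space M" for x
  proof -
    have "(\<lambda>n. (norm (\<phi> x - F n x))\<^sup>2) \<longlonglongrightarrow> (norm (\<phi> x - \<phi> x))\<^sup>2"
      by (intro tendsto_intros F(2) that)
    then show ?thesis
      by simp
  qed
  have meas_n: "(\<lambda>x. (norm (\<phi> x - F n x))\<^sup>2) \<in> borel_measurable M" for n
    using meas F_meas[of n] by simp
  show thesis
  proof
    show "simple_function M (F n)" for n
      by (rule F(1))
    show "integrable M (\<lambda>x. (norm (\<phi> x - F n x))\<^sup>2)" for n
      using bound by (intro Bochner_Integration.integrable_bound[OF dom meas_n] AE_I2) simp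
    have "(\<lambda>n. LINT x|M. (norm (\<phi> x - F n x))\<^sup>2) \<longlonglongrightarrow> (LINT x|M. 0)"
      by (rule integral_dominated_convergence[OF borel_measurable_const meas_n dom AE_I2[OF lim] AE_I2[OF bound]])
    then show "(\<lambda>n. LINT x|M. (norm (\<phi> x - F n x))\<^sup>2) \<longlonglongrightarrow> 0"
      by simp
  qed
qed

text \<open>
The hypothesis covers both \<open>(u, v)\<close> and \<open>(v, u)\<close> because the estimate for block densities concerns the
symmetrised projection; its error term vanishes as the simple functions approach \<open>\<phi>\<close>.
\<close>

lemma kernel_nonneg_of_copula_projections_nonneg:
  fixes \<phi> :: "real \<Rightarrow> real^'p::finite"
  assumes orth: "L2_orthonormal (lebesgue_on {0..1}) (\<lambda>i t. \<phi> t $ i)"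
    and pos: "\<And>c. c \<in> L2 (lebesgue_on unit_square) \<Longrightarrow> copula_density c \<Longrightarrow>
      0 \<le> copula_projection \<phi> c (u, v) \<and> 0 \<le> copula_projection \<phi> c (v, u)"
  shows "0 \<le> \<phi> u \<bullet> \<phi> v"
proof -
  let ?I = "lebesgue_on {0..1::real}"
  obtain F where F: "\<And>n. simple_function ?I (F n)"
    "\<And>n. integrable ?I (\<lambda>x. (norm (\<phi> x - F n x))\<^sup>2)"
    "(\<lambda>n. LINT x|?I. (norm (\<phi> x - F n x))\<^sup>2) \<longlonglongrightarrow> 0"
    using simple_functions_approximate_L2[OF orth] by blast
  let ?bound = "\<lambda>n. 2 * (\<phi> u \<bullet> \<phi> v) + 4 * (norm (\<phi> u) * norm (\<phi> v)) * (LINT x|?I. (norm (\<phi> x - F n x))\<^sup>2)"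
  have "0 \<le> ?bound n" for n
  proof -
    let ?c = "block_density (F n)"
    note c = block_density_L2[OF F(1), of n] copula_density_block_density[OF F(1), of n]
    have "0 \<le> copula_projection \<phi> ?c (u, v) + copula_projection \<phi> ?c (v, u)"
      using pos[OF c] by simp
    also have "\<dots> \<le> ?bound n"
      by (rule copula_projection_le_inner[OF orth c _ F(2)]) (auto simp: block_density_def split: if_splits)
    finally show ?thesis .
  qed
  moreover have "?bound \<longlonglongrightarrow> 2 * (\<phi> u \<bullet> \<phi> v) + 4 * (norm (\<phi> u) * norm (\<phi> v)) * 0"
    by (intro tendsto_intros F(3))
  ultimately have "0 \<le> 2 * (\<phi> u \<bullet> \<phi> v) + 4 * (norm (\<phi> u) * norm (\<phi> v)) * 0"
    by (intro LIMSEQ_le_const) auto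
  then show ?thesis
    by simp
qed

theorem theorem1:
  fixes \<phi> :: "real \<Rightarrow> real^'p" and k :: "'p::finite"
  assumes "CARD('p) \<ge> 2"
    and "L2_orthonormal (lebesgue_on {0..1}) (\<lambda>i t. \<phi> t $ i)"
    and "\<forall>t\<in>{0..1}. \<phi> t $ k = 1"
  shows "(\<forall>c \<in> L2 (lebesgue_on unit_square).
            is_L2_projection (lebesgue_on unit_square)
              (real_fun.span {(\<lambda>t. \<phi> t $ i) \<otimes> (\<lambda>t. \<phi> t $ j) |i j. True})
              c (copula_projection \<phi> c)) \<and>
         ((\<forall>c \<in> L2 (lebesgue_on unit_square). copula_density c \<longrightarrow>
              copula_projection \<phi> c \<in> copula_class k \<phi>)
            \<longleftrightarrow> mat 1 \<in> admissible_matrices k \<phi>)"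
proof (intro conjI ballI iffI impI)
  note orth = assms(2)
  show "is_L2_projection (lebesgue_on unit_square)
      (real_fun.span {(\<lambda>t. \<phi> t $ i) \<otimes> (\<lambda>t. \<phi> t $ j) |i j. True}) c (copula_projection \<phi> c)"
    if "c \<in> L2 (lebesgue_on unit_square)" for c
    by (rule copula_projection_is_L2_projection[OF orth that])
  show "mat 1 \<in> admissible_matrices k \<phi>"
    if *: "\<forall>c \<in> L2 (lebesgue_on unit_square). copula_density c \<longrightarrow> copula_projection \<phi> c \<in> copula_class k \<phi>"
  proof -
    have nonneg: "0 \<le> copula_projection \<phi> c (u, v)"
      if "c \<in> L2 (lebesgue_on unit_square)" "copula_density c" "u \<in> {0..1}" "v \<in> {0..1}" for c u v
      using *[rule_format, OF that(1,2)] that(3,4) by (auto simp: copula_class_def admissible_matrices_def)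
    have "0 \<le> \<phi> u \<bullet> \<phi> v" if "u \<in> {0..1}" "v \<in> {0..1}" for u v
      using nonneg that by (intro kernel_nonneg_of_copula_projections_nonneg[OF orth]) auto
    then show ?thesis
      by (auto simp: admissible_matrices_def transpose_mat)
  qed
  show "copula_projection \<phi> c \<in> copula_class k \<phi>"
    if mat: "mat 1 \<in> admissible_matrices k \<phi>"
      and c: "c \<in> L2 (lebesgue_on unit_square)" "copula_density c" for c
  proof -
    have pos: "0 \<le> \<phi> x \<bullet> \<phi> y" if "x \<in> {0..1}" "y \<in> {0..1}" for x y
      using mat that by (simp add: admissible_matrices_def)
    have "0 \<le> \<phi> u \<bullet> (coefficient_matrix \<phi> c *v \<phi> v)" if "u \<in> {0..1}" "v \<in> {0..1}" for u v
      using copula_projection_nonneg[OF orth c(1) _ pos that] c(2)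
      by (auto simp: copula_projection_def copula_density_def)
    then have "coefficient_matrix \<phi> c \<in> admissible_matrices k \<phi>"
      using coefficient_matrix_copula_axis[OF orth assms(3) c(2)] by (simp add: admissible_matrices_def)
    then show ?thesis
      by (auto simp: copula_class_def copula_projection_def)
  qed
qed

end
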